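(* Let $n\ge 1$ be an integer, let $1<p<\infty$ and let $0\le s<\frac{n}{p}$. Then there exists a constant $C$ (depending only on $n$, $p$ and $s$) such that for every $u\in \dot W^{s,p}(\mathbb{R}^n)$, $$\int_{\mathbb{R}^n}\frac{|u(x)|^p}{|x|^{sp}}\,dx\le C\,\|u\|_{\dot W^{s,p}}^p .$$
   Context: For $0<\alpha<n$ the Riesz potential of order $\alpha$ is $$I_\alpha f(x)=(-\Delta)^{-\alpha/2}f(x)=C_{n,\alpha}\int_{\mathbb{R}^n}|x-y|^{-n+\alpha}f(y)\,dy,$$ where $C_{n,\alpha}>0$ is the constant, depending only on $n$ and $\alpha$, for which this operator is $(-\Delta)^{-\alpha/2}$, i.e. $C_{n,\alpha}=\frac{\Gamma((n-\alpha)/2)}{\pi^{n/2}2^{\alpha}\Gamma(\alpha/2)}$. For $\alpha=0$, $I_0$ is the identity. If $1<p<\infty$ and $0<\alpha<n/p$, the integral converges absolutely for almost every $x$ for every $f\in L^p(\mathbb{R}^n)$, and $I_\alpha$ is injective on $L^p(\mathbb{R}^n)$. The homogeneous Sobolev norm is $\|u\|_{\dot W^{s,p}}=\|(-\Delta)^{s/2}u\|_{L^p}=\|I_{-s}u\|_{L^p}$, where $I_{-s}=(-\Delta)^{s/2}$ is the inverse of $I_s$. For $1<p<\infty$ and $0\le s<n/p$, the space $\dot W^{s,p}(\mathbb{R}^n)$ consists of the (a.e. defined) functions $u=I_sf$ with $f\in L^p(\mathbb{R}^n)$, where $f=I_{-s}u$, and $\|u\|_{\dot W^{s,p}}=\|f\|_{L^p}$.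 Functions may be real- or complex-valued. *)

theory Defs
  imports "HOL-Analysis.Analysis"
begin

text \<open>
  Functions are complex-valued (this contains the real-valued case) and, as elements of function
  spaces, identified when they agree almost everywhere with respect to Lebesgue measure.
\<close>

definition Lp_space :: "real \<Rightarrow> (real^'n \<Rightarrow> complex) set" where
  "Lp_space p = {f \<in> borel_measurable lebesgue. integrable lebesgue (\<lambda>x. norm (f x) powr p)}"

definition Lp_norm :: "real \<Rightarrow> (real^'n \<Rightarrow> complex) \<Rightarrow> real" where
  "Lp_norm p f = (LINT x|lebesgue. norm (f x) powr p) powr (1 / p)"

definition riesz_const :: "nat \<Rightarrow> real \<Rightarrow> real" where
  "riesz_const n \<alpha> =
     Gamma ((real n - \<alpha>) / 2) / (pi powr (real n / 2) * 2 powr \<alpha> * Gamma (\<alpha> / 2))"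

text \<open>
  The value of the kernel at \<open>y = x\<close> is irrelevant, a point being a null set.  The same
  goes for the (null) set of \<open>x\<close> where the integral does not converge absolutely, on
  which the Bochner integral is \<open>0\<close> by convention.
\<close>

definition riesz_potential :: "real \<Rightarrow> (real^'n \<Rightarrow> complex) \<Rightarrow> real^'n \<Rightarrow> complex" where
  "riesz_potential \<alpha> f x =
     (if \<alpha> = 0 then f x
      else riesz_const CARD('n) \<alpha> *\<^sub>R
             (LINT y|lebesgue. (norm (x - y) powr (\<alpha> - real CARD('n))) *\<^sub>R f y))"

definition hom_sobolev_space :: "real \<Rightarrow> real \<Rightarrow> (real^'n \<Rightarrow> complex) set" where
  "hom_sobolev_space s p =
     {u. \<exists>f \<in> Lp_space p. AE x in lebesgue. u x = riesz_potential s f x}"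

text \<open>
  The inverse \<open>I\<^sub>-\<^sub>s = (-\<Delta>)\<^bsup>s/2\<^esup>\<close> of \<open>I\<^sub>s\<close> on \<open>L\<^sup>p\<close>.  Since
  \<open>I\<^sub>s\<close> is injective on \<open>L\<^sup>p\<close> for \<open>0 \<le> s < n/p\<close>, the choice is unique up
  to a null set, and the norm below does not depend on it.
\<close>

definition riesz_inverse :: "real \<Rightarrow> real \<Rightarrow> (real^'n \<Rightarrow> complex) \<Rightarrow> real^'n \<Rightarrow> complex" where
  "riesz_inverse s p u =
     (SOME f. f \<in> Lp_space p \<and> (AE x in lebesgue. u x = riesz_potential s f x))"

definition hom_sobolev_norm :: "real \<Rightarrow> real \<Rightarrow> (real^'n \<Rightarrow> complex) \<Rightarrow> real" where
  "hom_sobolev_norm s p u = Lp_norm p (riesz_inverse s p u)"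

end

theory Submission
  imports Defs
begin

text \<open>
  This is Schur's test for the kernel \<open>|x|\<^bsup>-s\<^esup> |x - y|\<^bsup>s-n\<^esup>\<close>, which is homogeneous of degree
  \<open>-n\<close>, with a power weight \<open>|y|\<^bsup>-a\<^esup>\<close>.  Everything rests on the bound
  \<open>\<integral> |x - y|\<^bsup>s-n\<^esup> |y|\<^bsup>-a\<^esup> dy \<le> A |x|\<^bsup>s-a\<^esup>\<close> for \<open>s < a < n\<close>.  It is used once in \<open>y\<close>
  with the exponent \<open>a\<close> and once in \<open>x\<close> with the exponent \<open>b = s + a(p - 1)\<close>; an \<open>a\<close> with both
  \<open>s < a < n\<close> and \<open>b < n\<close> exists because \<open>s p < n\<close>.  The resulting bound holds for
  every \<open>f\<close> with \<open>u = I\<^sub>s f\<close>, so the choice made in \<open>riesz_inverse\<close> is immaterial.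
\<close>

section \<open>Integrals of powers of the norm over balls and their complements\<close>

text \<open>On the shell of radius about \<open>r = R * 2 powr (\<sigma> * k)\<close> the integrand
  is at most \<open>(r / 2) powr (-a)\<close> and the volume is O(\<open>r ^ n\<close>). The
  contributions are thus of order \<open>r powr (n - a)\<close> and form a geometric series of ratio
  \<open>2 powr (\<sigma> * (n - a)) < 1\<close>. Taking \<sigma> = -1 handles balls (a < n), and
  \<sigma> = 1 handles their complements (a > n).\<close>

lemma nn_integral_dyadic_shells_le:
  fixes a \<sigma> :: real
  assumes a: "0 < a" and \<sigma>: "\<sigma> * (real DIM('a) - a) < 0"
  shows "\<exists>A\<ge>0. \<forall>R>0. \<forall>S\<in>sets borel.
           (\<forall>y\<in>S. y \<noteq> 0 \<longrightarrow> (\<exists>k::nat. R * 2 powr (\<sigma> * k) / 2 \<le> norm y \<and> norm y \<le> 2 * R * 2 powr (\<sigma> * k))) \<longrightarrow>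
           (\<integral>\<^sup>+ (y::'a::euclidean_space). ennreal (norm y powr (-a) * indicator S y) \<partial>lborel)
             \<le> ennreal (A * R powr (real DIM('a) - a))"
proof -
  define n where "n = DIM('a)"
  define t where "t = 2 powr (\<sigma> * (real n - a))"
  define V where "V = unit_ball_vol (real n)"
  have t: "0 < t" "t < 1"
    using \<sigma> by (auto simp: t_def n_def powr_less_one)
  have V: "V > 0" by (simp add: V_def)
  \<comment> \<open>The factor \<open>2 powr a\<close> comes from the inner radius
    \<open>r k / 2\<close>, \<open>2 powr n\<close> from the ball of radius \<open>2 * r k\<close>,
    and \<open>1 / (1 - t)\<close> is the sum of the geometric series.\<close>
  define A where "A = V * 2 powr (a + n) / (1 - t)"
  have A: "A \<ge> 0" using t V by (simp add: A_def)
  show ?thesis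
  proof (intro exI[of _ A] conjI A allI impI ballI)
    fix R :: real and S :: "'a set"
    assume R: "R > 0" and S: "S \<in> sets borel"
      and cov: "\<forall>y\<in>S. y \<noteq> 0 \<longrightarrow> (\<exists>k::nat. R * 2 powr (\<sigma> * k) / 2 \<le> norm y \<and> norm y \<le> 2 * R * 2 powr (\<sigma> * k))"
    define r where "r k = R * 2 powr (\<sigma> * real k)" for k :: nat
    \<comment> \<open>The full ball replaces the shell: overlaps do no harm to an upper bound, and
      the volume is explicit.\<close>
    define g where "g k y = ennreal ((r k / 2) powr (-a)) * indicator (cball 0 (2 * r k)) y" for k :: nat and y :: 'a
    have [measurable]: "g k \<in> borel_measurable borel" for k
      unfolding g_def[abs_def]
      by (intro borel_measurable_times_ennreal borel_measurable_const borel_measurable_indicator borel_closed closed_cball)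
    have r: "r k > 0" for k using R by (simp add: r_def)
    have ptw: "ennreal (norm y powr (-a) * indicator S y) \<le> (\<Sum>k. g k y)" for y :: 'a
    proof (cases "y \<in> S \<and> y \<noteq> 0")
      case True
      then obtain k :: nat where k: "r k / 2 \<le> norm y" "norm y \<le> 2 * r k"
        using cov by (auto simp: r_def mult.assoc)
      have "norm y powr (-a) \<le> (r k / 2) powr (-a)"
        using k r[of k] a by (intro powr_mono2') auto
      then have "ennreal (norm y powr (-a) * indicator S y) \<le> g k y"
        using k True by (auto simp: g_def dist_norm intro!: ennreal_leI)
      also have "\<dots> = (\<Sum>i\<in>{k}. g i y)" by simp
      also have "\<dots> \<le> (\<Sum>k. g k y)"
        by (intro sum_le_suminf) auto
      finally show ?thesis .
    \<comment> \<open>At the origin the left side vanishes as well, because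
      \<open>0 powr (-a) = 0\<close>.\<close>
    qed auto
    have int: "(\<integral>\<^sup>+ y. g k y \<partial>lborel) = ennreal (V * 2 powr (a + n) * R powr (real n - a) * t ^ k)" for k
    proof -
      have "(\<integral>\<^sup>+ y. g k y \<partial>lborel) = ennreal ((r k / 2) powr (-a)) * ennreal (V * (2 * r k) ^ n)"
        unfolding g_def V_def n_def using r[of k] by (subst nn_integral_cmult) (auto simp: emeasure_cball intro!: borel_measurable_indicator)
      also have "\<dots> = ennreal ((r k / 2) powr (-a) * (V * (2 * r k) ^ n))"
        using V r[of k] by (simp add: ennreal_mult)
      also have "(r k / 2) powr (-a) * (V * (2 * r k) ^ n) = V * 2 powr (a + n) * (r k) powr (real n - a)"
        using r[of k] by (simp add: powr_add powr_diff powr_minus powr_divide powr_realpow power_mult_distrib field_simps)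
      also have "(r k) powr (real n - a) = R powr (real n - a) * t ^ k"
        using R by (simp add: r_def t_def powr_mult powr_powr flip: powr_realpow) (simp add: algebra_simps)
      finally show ?thesis by (simp add: mult.assoc)
    qed
    have "(\<integral>\<^sup>+ y. ennreal (norm y powr (-a) * indicator S y) \<partial>lborel) \<le> (\<integral>\<^sup>+ y. (\<Sum>k. g k y) \<partial>lborel)"
      by (intro nn_integral_mono ptw)
    also have "\<dots> = (\<Sum>k. ennreal (V * 2 powr (a + n) * R powr (real n - a) * t ^ k))"
      by (subst nn_integral_suminf) (simp_all add: int del: ennreal_suminf_cmult)
    also have "\<dots> = ennreal (V * 2 powr (a + n) * R powr (real n - a) * (1 / (1 - t)))"
      using t V by (intro suminf_ennreal_eq sums_mult geometric_sums) auto
    finally show "(\<integral>\<^sup>+ y. ennreal (norm y powr (-a) * indicator S y) \<partial>lborel) \<le> ennreal (A * R powr (real DIM('a) - a))"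
      by (simp add: A_def n_def mult_ac)
  qed
qed

lemma nn_integral_norm_powr_cball_le:
  fixes a :: real
  assumes a: "0 < a" "a < real DIM('a)"
  shows "\<exists>A\<ge>0. \<forall>R>0. (\<integral>\<^sup>+ (y::'a::euclidean_space). ennreal (norm y powr (-a) * indicator (cball 0 R) y) \<partial>lborel)
             \<le> ennreal (A * R powr (real DIM('a) - a))"
proof -
  have *: "\<exists>k::nat. R * 2 powr (-1 * k) / 2 \<le> norm y \<and> norm y \<le> 2 * R * 2 powr (-1 * k)"
    if "R > 0" "y \<in> cball 0 R" "y \<noteq> 0" for R :: real and y :: 'a
  proof -
    define l where "l = log 2 (R / norm y)"
    have l: "l \<ge> 0" using that by (auto simp: l_def zero_le_log_cancel_iff)
    have y: "norm y = R * 2 powr (- l)"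
      using that by (simp add: l_def powr_minus)
    \<comment> \<open>The integer part of \<open>l\<close> selects the shell; the rounding error of
      at most 1 is absorbed by the factors 2 in the bounds of the shell.\<close>
    define k where "k = nat \<lfloor>l\<rfloor>"
    have k: "real k \<le> l" "l \<le> real k + 1" using l by (auto simp: k_def)
    have "2 powr (-1 * real k) \<le> 2 powr (1 + (-l))" "2 powr (-l) \<le> 2 powr (1 + (-1 * real k))"
      using k by (auto intro!: powr_mono simp del: mult_minus1)
    then show ?thesis
      using \<open>R > 0\<close> unfolding y powr_add by (intro exI[of _ k] conjI) simp_all
  qed
  show ?thesis
  proof -
    obtain A where "A \<ge> 0" and A: "\<And>R S. \<lbrakk>R > 0; S \<in> sets borel;
        \<And>y. y \<in> S \<Longrightarrow> y \<noteq> 0 \<Longrightarrow> \<exists>k::nat. R * 2 powr (-1 * k) / 2 \<le> norm y \<and> norm y \<le> 2 * R * 2 powr (-1 * k)\<rbrakk> \<Longrightarrow>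
        (\<integral>\<^sup>+ (y::'a). ennreal (norm y powr (-a) * indicator S y) \<partial>lborel) \<le> ennreal (A * R powr (real DIM('a) - a))"
      using nn_integral_dyadic_shells_le[where 'a = 'a, of a "-1"] a by auto
    then show ?thesis
      using * by (intro exI[of _ A] conjI allI impI A) (auto intro: borel_closed borel_comp)
  qed
qed

text \<open>Mirror image of the ball case: the shells now grow, and a > n makes their contributions
  decay.\<close>

lemma nn_integral_norm_powr_outside_cball_le:
  fixes a :: real
  assumes a: "real DIM('a) < a"
  shows "\<exists>A\<ge>0. \<forall>R>0. (\<integral>\<^sup>+ (y::'a::euclidean_space). ennreal (norm y powr (-a) * indicator (- cball 0 R) y) \<partial>lborel)
             \<le> ennreal (A * R powr (real DIM('a) - a))"
proof -
  have *: "\<exists>k::nat. R * 2 powr (1 * k) / 2 \<le> norm y \<and> norm y \<le> 2 * R * 2 powr (1 * k)"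
    if "R > 0" "y \<in> - cball 0 R" "y \<noteq> 0" for R :: real and y :: 'a
  proof -
    define l where "l = log 2 (norm y / R)"
    have l: "l \<ge> 0" using that by (auto simp: l_def zero_le_log_cancel_iff)
    have y: "norm y = R * 2 powr l"
      using that by (simp add: l_def)
    define k where "k = nat \<lfloor>l\<rfloor>"
    have k: "real k \<le> l" "l \<le> real k + 1" using l by (auto simp: k_def)
    have "2 powr (1 * real k) \<le> 2 powr (1 + l)" "2 powr l \<le> 2 powr (1 + 1 * real k)"
      using k by (auto intro!: powr_mono)
    then show ?thesis
      using \<open>R > 0\<close> unfolding y powr_add by (intro exI[of _ k] conjI) simp_all
  qed
  have "a > 0" using a by (meson less_trans DIM_positive of_nat_0_less_iff)
  show ?thesis
  proof -
    obtain A where "A \<ge> 0" and A: "\<And>R S. \<lbrakk>R > 0; S \<in> sets borel;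
        \<And>y. y \<in> S \<Longrightarrow> y \<noteq> 0 \<Longrightarrow> \<exists>k::nat. R * 2 powr (1 * k) / 2 \<le> norm y \<and> norm y \<le> 2 * R * 2 powr (1 * k)\<rbrakk> \<Longrightarrow>
        (\<integral>\<^sup>+ (y::'a). ennreal (norm y powr (-a) * indicator S y) \<partial>lborel) \<le> ennreal (A * R powr (real DIM('a) - a))"
      using nn_integral_dyadic_shells_le[where 'a = 'a, of a 1] a \<open>a > 0\<close> by auto
    then show ?thesis
      using * by (intro exI[of _ A] conjI allI impI A) (auto intro: borel_closed borel_comp)
  qed
qed

section \<open>The Riesz kernel integrated against a power weight\<close>

lemma nn_integral_lborel_reflect:
  fixes f :: "'a::euclidean_space \<Rightarrow> ennreal"
  assumes [measurable]: "f \<in> borel_measurable borel"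
  shows "(\<integral>\<^sup>+ y. f (x - y) \<partial>lborel) = (\<integral>\<^sup>+ y. f y \<partial>lborel)"
proof -
  \<comment> \<open>The scaling factor is -1, so the Jacobian density is 1.\<close>
  have "(\<integral>\<^sup>+ y. f y \<partial>lborel) = (\<integral>\<^sup>+ y. f y \<partial>distr lborel borel (\<lambda>y. x + (-1) *\<^sub>R y))"
    using lborel_affine[of "-1" x] by (simp add: density_1)
  then show ?thesis by (simp add: nn_integral_distr)
qed

text \<open>Split space at distance \<open>r = norm x / 2\<close> from 0 and from x. Near 0 the
  kernel is at most \<open>r powr (s - n)\<close> and the weight is integrable since a < n. Near x
  the weight is at most \<open>r powr (-a)\<close> and the kernel is integrable since s > 0.
  Elsewhere the product is dominated by a multiple of \<open>norm y powr (s - n - a)\<close>,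
  integrable at infinity since s < a. Each region contributes a multiple of
  \<open>r powr (s - a)\<close>.\<close>

lemma riesz_kernel_norm_powr_le:
  fixes a s :: real
  assumes s: "0 < s" "s < a" and a: "a < real DIM('a)"
  shows "\<exists>A>0. \<forall>x::'a::euclidean_space. x \<noteq> 0 \<longrightarrow>
     (\<integral>\<^sup>+ y. ennreal (norm (x - y) powr (s - real DIM('a)) * norm y powr (-a)) \<partial>lborel)
       \<le> ennreal (A * norm x powr (s - a))"
proof -
  define n where "n = real DIM('a)"
  obtain A1 where A1: "A1 \<ge> 0" "\<And>R. R > 0 \<Longrightarrow>
      (\<integral>\<^sup>+ (y::'a). ennreal (norm y powr (-a) * indicator (cball 0 R) y) \<partial>lborel) \<le> ennreal (A1 * R powr (n - a))"
    using nn_integral_norm_powr_cball_le[where 'a = 'a, of a] s a unfolding n_def by auto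
  obtain A2 where A2: "A2 \<ge> 0" "\<And>R. R > 0 \<Longrightarrow>
      (\<integral>\<^sup>+ (y::'a). ennreal (norm y powr (s - n) * indicator (cball 0 R) y) \<partial>lborel) \<le> ennreal (A2 * R powr s)"
    using nn_integral_norm_powr_cball_le[where 'a = 'a, of "n - s"] s a unfolding n_def by auto
  obtain A3 where A3: "A3 \<ge> 0" "\<And>R. R > 0 \<Longrightarrow>
      (\<integral>\<^sup>+ (y::'a). ennreal (norm y powr (s - n - a) * indicator (- cball 0 R) y) \<partial>lborel) \<le> ennreal (A3 * R powr (s - a))"
    using nn_integral_norm_powr_outside_cball_le[where 'a = 'a, of "n + a - s"] s a unfolding n_def
    by (auto simp: algebra_simps)
  \<comment> \<open>The summand 1 makes \<open>A\<close> strictly positive, as the later Hoelder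
    step requires; \<open>2 powr (a - s)\<close> converts \<open>r powr (s - a)\<close> into a power
    of \<open>norm x\<close>.\<close>
  define A where "A = (A1 + A2 + 3 powr (n - s) * A3 + 1) * 2 powr (a - s)"
  have A: "A > 0" using A1 A2 A3 by (auto simp: A_def intro!: mult_pos_pos add_nonneg_pos)
  show ?thesis
  proof (intro exI[of _ A] conjI A allI impI)
    fix x :: 'a assume x: "x \<noteq> 0"
    define r where "r = norm x / 2"
    have r: "r > 0" using x by (simp add: r_def)
    define g1 where "g1 y = ennreal (r powr (s - n)) * ennreal (norm y powr (-a) * indicator (cball 0 r) y)" for y :: 'a
    \<comment> \<open>\<open>h2\<close> is centred at the origin, so that \<open>g2\<close> is its
      reflection about x/2 up to a factor and has an integral computable over a centred
      ball.\<close>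
    define h2 where "h2 y = ennreal (norm y powr (s - n) * indicator (cball 0 r) y)" for y :: 'a
    define g2 where "g2 y = ennreal (r powr (-a)) * h2 (x - y)" for y
    define g3 where "g3 y = ennreal (3 powr (n - s)) * ennreal (norm y powr (s - n - a) * indicator (- cball 0 r) y)" for y :: 'a
    have [measurable]: "cball (0::'a) r \<in> sets borel" "- cball (0::'a) r \<in> sets borel"
      by (auto intro: borel_closed borel_comp)
    have [measurable]: "g1 \<in> borel_measurable borel" "h2 \<in> borel_measurable borel"
        "g2 \<in> borel_measurable borel" "g3 \<in> borel_measurable borel"
      unfolding g1_def[abs_def] g2_def[abs_def] g3_def[abs_def] h2_def[abs_def]
      by measurable
    have tri: "norm x \<le> norm y + norm (x - y)" "norm y \<le> norm x + norm (x - y)" for y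
      using norm_triangle_ineq[of y "x - y"] norm_triangle_ineq4[of x "x - y"] by auto
    have ptw: "ennreal (norm (x - y) powr (s - n) * norm y powr (-a)) \<le> g1 y + g2 y + g3 y" for y
    proof -
      consider "norm y \<le> r" | "norm (x - y) \<le> r" "norm y > r" | "norm (x - y) > r" "norm y > r" by linarith
      then show ?thesis
      proof cases
        case 1
        then have "r \<le> norm (x - y)" using tri[of y] by (simp add: r_def)
        then have "norm (x - y) powr (s - n) \<le> r powr (s - n)"
          using r s a by (intro powr_mono2') (auto simp: n_def)
        then have "ennreal (norm (x - y) powr (s - n) * norm y powr (-a)) \<le> g1 y"
          using 1 by (auto simp: g1_def ennreal_mult mult_right_mono simp flip: ennreal_mult intro!: ennreal_leI)
        then show ?thesis by (meson add_increasing2 order_trans zero_le)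
      next
        case 2
        have "norm y powr (-a) \<le> r powr (-a)"
          using 2 r s by (intro powr_mono2') auto
        then have "ennreal (norm (x - y) powr (s - n) * norm y powr (-a)) \<le> g2 y"
          using 2 by (auto simp: g2_def h2_def mult.commute mult_right_mono simp flip: ennreal_mult intro!: ennreal_leI)
        then show ?thesis by (meson add_increasing add_increasing2 order_trans zero_le)
      next
        case 3
        \<comment> \<open>Here \<open>norm x = 2 * r < 2 * norm (x - y)\<close>, so the triangle
          inequality yields the factor 3.\<close>
        then have "norm y / 3 \<le> norm (x - y)" using tri[of y] by (simp add: r_def)
        then have "norm (x - y) powr (s - n) \<le> (norm y / 3) powr (s - n)"
          using 3 r s a by (intro powr_mono2') (auto simp: n_def)
        also have "\<dots> = 3 powr (n - s) * norm y powr (s - n)"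
          by (simp add: powr_divide powr_diff)
        finally have "norm (x - y) powr (s - n) * norm y powr (-a) \<le> 3 powr (n - s) * norm y powr (s - n) * norm y powr (-a)"
          by (rule mult_right_mono) simp
        also have "\<dots> = 3 powr (n - s) * norm y powr (s - n - a)"
          by (simp add: mult.assoc flip: powr_add)
        finally have "ennreal (norm (x - y) powr (s - n) * norm y powr (-a)) \<le> g3 y"
          using 3 by (auto simp: g3_def simp flip: ennreal_mult intro!: ennreal_leI)
        then show ?thesis by (meson add_increasing order_trans zero_le)
      qed
    qed
    have i1: "(\<integral>\<^sup>+ y. g1 y \<partial>lborel) \<le> ennreal (A1 * r powr (s - a))"
    proof -
      have "(\<integral>\<^sup>+ y. g1 y \<partial>lborel) \<le> ennreal (r powr (s - n)) * ennreal (A1 * r powr (n - a))"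
        unfolding g1_def by (subst nn_integral_cmult) (auto intro!: mult_left_mono A1 r)
      also have "\<dots> = ennreal (A1 * r powr (s - a))"
        using A1 r by (simp flip: ennreal_mult powr_add add: mult.left_commute)
      finally show ?thesis .
    qed
    have i2: "(\<integral>\<^sup>+ y. g2 y \<partial>lborel) \<le> ennreal (A2 * r powr (s - a))"
    proof -
      have "(\<integral>\<^sup>+ y. g2 y \<partial>lborel) = ennreal (r powr (-a)) * (\<integral>\<^sup>+ y. h2 y \<partial>lborel)"
        unfolding g2_def by (subst nn_integral_cmult) (auto simp: nn_integral_lborel_reflect)
      also have "\<dots> \<le> ennreal (r powr (-a)) * ennreal (A2 * r powr s)"
        unfolding h2_def by (intro mult_left_mono A2 r) auto
      also have "\<dots> = ennreal (A2 * r powr (s - a))"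
        using A2 r by (simp flip: ennreal_mult powr_add add: mult.left_commute)
      finally show ?thesis .
    qed
    have i3: "(\<integral>\<^sup>+ y. g3 y \<partial>lborel) \<le> ennreal (3 powr (n - s) * A3 * r powr (s - a))"
    proof -
      have "(\<integral>\<^sup>+ y. g3 y \<partial>lborel) \<le> ennreal (3 powr (n - s)) * ennreal (A3 * r powr (s - a))"
        unfolding g3_def by (subst nn_integral_cmult) (auto intro!: mult_left_mono A3 r)
      also have "\<dots> = ennreal (3 powr (n - s) * A3 * r powr (s - a))"
        using A3 by (simp flip: ennreal_mult add: mult.assoc)
      finally show ?thesis .
    qed
    have "(\<integral>\<^sup>+ y. ennreal (norm (x - y) powr (s - n) * norm y powr (-a)) \<partial>lborel)
        \<le> (\<integral>\<^sup>+ y. g1 y + g2 y + g3 y \<partial>lborel)"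
      by (intro nn_integral_mono ptw)
    also have "\<dots> = (\<integral>\<^sup>+ y. g1 y \<partial>lborel) + (\<integral>\<^sup>+ y. g2 y \<partial>lborel) + (\<integral>\<^sup>+ y. g3 y \<partial>lborel)"
      by (simp add: nn_integral_add)
    also have "\<dots> \<le> ennreal (A1 * r powr (s - a)) + ennreal (A2 * r powr (s - a)) + ennreal (3 powr (n - s) * A3 * r powr (s - a))"
      by (intro add_mono i1 i2 i3)
    also have "\<dots> = ennreal ((A1 + A2 + 3 powr (n - s) * A3) * r powr (s - a))"
      using A1 A2 A3 by (simp add: ring_distribs)
    also have "\<dots> \<le> ennreal ((A1 + A2 + 3 powr (n - s) * A3 + 1) * r powr (s - a))"
      by (intro ennreal_leI mult_right_mono) auto
    also have "r powr (s - a) = 2 powr (a - s) * norm x powr (s - a)"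
      by (simp add: r_def powr_divide powr_diff)
    finally show "(\<integral>\<^sup>+ y. ennreal (norm (x - y) powr (s - real DIM('a)) * norm y powr (-a)) \<partial>lborel)
       \<le> ennreal (A * norm x powr (s - a))"
      by (simp add: A_def n_def mult.assoc)
  qed
qed

section \<open>A weighted Hoelder inequality\<close>

text \<open>Where f exceeds \<open>\<mu> * w\<close>, the factor
  \<open>(f / (\<mu> * w)) powr (p - 1)\<close> is at least 1, and f times this factor is the second
  summand; elsewhere the first summand suffices.\<close>

lemma le_weight_add_powr:
  fixes p w f \<mu> :: real
  assumes "1 \<le> p" "0 < w" "0 < \<mu>" "0 \<le> f"
  shows "f \<le> \<mu> * w + \<mu> powr (1 - p) * (f powr p * w powr (1 - p))"
proof (cases "f \<le> \<mu> * w")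
  case True
  then show ?thesis by (meson add_increasing2 mult_nonneg_nonneg powr_ge_zero)
next
  case False
  then have f: "f > 0" using assms by (meson less_trans mult_pos_pos not_le)
  have "1 \<le> (f / (\<mu> * w)) powr (p - 1)"
    using assms False by (intro ge_one_powr_ge_zero) (auto simp: field_simps)
  then have "f * 1 \<le> f * (f / (\<mu> * w)) powr (p - 1)"
    using f by (intro mult_left_mono) auto
  also have "\<dots> = \<mu> powr (1 - p) * (f powr p * w powr (1 - p))"
    using f assms by (simp add: powr_divide powr_mult powr_diff field_simps)
  finally show ?thesis using assms by (simp add: add_increasing)
qed

text \<open>
  Hoelder's inequality for the measure \<open>K dy\<close>, up to the factor \<open>2\<^sup>p\<close>: integrate
  \<open>f \<le> \<mu> w + \<mu>\<^bsup>1-p\<^esup> f\<^sup>p w\<^bsup>1-p\<^esup>\<close> and optimise over \<open>\<mu>\<close>.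
\<close>

lemma powr_nn_integral_weight_le:
  fixes K w F :: "'a \<Rightarrow> real" and p B G :: real
  assumes [measurable]: "K \<in> borel_measurable M" "w \<in> borel_measurable M" "F \<in> borel_measurable M"
    and p: "1 < p" and K: "\<And>y. 0 \<le> K y" and w: "AE y in M. 0 < w y" and F: "\<And>y. 0 \<le> F y"
    and B: "0 < B" "(\<integral>\<^sup>+ y. ennreal (K y * w y) \<partial>M) \<le> ennreal B"
    and G: "0 \<le> G" "ennreal G \<le> (\<integral>\<^sup>+ y. ennreal (K y * F y) \<partial>M)"
  shows "ennreal (G powr p) \<le> ennreal (2 powr p * B powr (p - 1)) * (\<integral>\<^sup>+ y. ennreal (K y * (F y powr p * w y powr (1 - p))) \<partial>M)"
proof -
  define D where "D = (\<integral>\<^sup>+ y. ennreal (K y * (F y powr p * w y powr (1 - p))) \<partial>M)"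
  have main: "ennreal G \<le> ennreal (\<mu> * B) + ennreal (\<mu> powr (1 - p)) * D" if \<mu>: "\<mu> > 0" for \<mu>
  proof -
    have "ennreal G \<le> (\<integral>\<^sup>+ y. ennreal (K y * F y) \<partial>M)" by (rule G)
    also have "\<dots> \<le> (\<integral>\<^sup>+ y. ennreal \<mu> * ennreal (K y * w y) + ennreal (\<mu> powr (1 - p)) * ennreal (K y * (F y powr p * w y powr (1 - p))) \<partial>M)"
      using w
    proof (intro nn_integral_mono_AE, eventually_elim)
      case (elim y)
      have "K y * F y \<le> K y * (\<mu> * w y + \<mu> powr (1 - p) * (F y powr p * w y powr (1 - p)))"
        using p elim \<mu> by (intro mult_left_mono le_weight_add_powr F K) auto
      then have "ennreal (K y * F y) \<le> ennreal (\<mu> * (K y * w y) + \<mu> powr (1 - p) * (K y * (F y powr p * w y powr (1 - p))))"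
        by (intro ennreal_leI) (simp add: algebra_simps)
      also have "\<dots> = ennreal \<mu> * ennreal (K y * w y) + ennreal (\<mu> powr (1 - p)) * ennreal (K y * (F y powr p * w y powr (1 - p)))"
        using \<mu> elim K[of y] by (simp flip: ennreal_mult)
      finally show ?case .
    qed
    also have "\<dots> = ennreal \<mu> * (\<integral>\<^sup>+ y. ennreal (K y * w y) \<partial>M) + ennreal (\<mu> powr (1 - p)) * D"
      by (simp add: nn_integral_add nn_integral_cmult D_def)
    also have "\<dots> \<le> ennreal \<mu> * ennreal B + ennreal (\<mu> powr (1 - p)) * D"
      by (intro add_mono mult_left_mono B) auto
    finally show ?thesis using \<mu> B by (simp add: ennreal_mult)
  qed
  show ?thesis
  proof (cases D rule: ennreal_cases)
    case top
    then show ?thesis unfolding D_def[symmetric] using B by (simp add: ennreal_mult_top)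
  next
    case (real d)
    have main': "G \<le> \<mu> * B + \<mu> powr (1 - p) * d" if \<mu>: "\<mu> > 0" for \<mu>
      using main[OF \<mu>] real \<mu> B by (simp flip: ennreal_mult ennreal_plus)
    have "G powr p \<le> 2 powr p * B powr (p - 1) * d"
    proof (cases "d = 0")
      case True
      have "G \<le> 0"
      proof (rule ccontr)
        \<comment> \<open>With d = 0 only the term \<open>\<mu> * B\<close> survives; this \<mu>
          would give \<open>G <= G / 2\<close>.\<close>
        assume "\<not> G \<le> 0"
        then show False using main'[of "G / (2 * B)"] B True by auto
      qed
      with G True show ?thesis by simp
    next
      case False
      then have d: "d > 0" using real by simp
      \<comment> \<open>This choice makes the two summands of \<open>main'\<close> equal.\<close>
      define \<mu> where "\<mu> = (d / B) powr (1 / p)"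
      have \<mu>: "\<mu> > 0" using d B by (simp add: \<mu>_def)
      have "\<mu> powr p * B = d" using d B p by (simp add: \<mu>_def powr_powr)
      then have "\<mu> powr (1 - p) * d = \<mu> * B"
        using \<mu> by (auto simp: powr_diff)
      then have "G \<le> 2 * (\<mu> * B)" using main'[OF \<mu>] by linarith
      then have "G powr p \<le> (2 * (\<mu> * B)) powr p"
        using G p by (intro powr_mono2) auto
      also have "\<dots> = 2 powr p * (\<mu> powr p * B powr p)"
        using \<mu> B by (simp add: powr_mult)
      also have "\<mu> powr p * B powr p = B powr (p - 1) * d"
        using \<mu> B d p by (simp add: \<mu>_def powr_powr powr_diff)
      finally show ?thesis by (simp add: mult.assoc)
    qed
    then show ?thesis
      using real B unfolding D_def[symmetric] by (simp add: ennreal_leI flip: ennreal_mult)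
  qed
qed

section \<open>Schur's test for nonnegative functions\<close>

text \<open>\<open>G\<close> is tied to \<open>F\<close> only by an a.e. inequality, so that the
  modulus of a real- or complex-valued potential fits, including points where the integral diverges
  and the potential is 0 by convention.\<close>

lemma nn_integral_riesz_weighted_le:
  fixes p s :: real
  assumes p: "1 < p" and s: "0 < s" "s < real DIM('a) / p"
  shows "\<exists>A\<ge>0. \<forall>(F :: 'a::euclidean_space \<Rightarrow> real) G. F \<in> borel_measurable borel \<longrightarrow> (\<forall>y. 0 \<le> F y) \<longrightarrow> (\<forall>x. 0 \<le> G x) \<longrightarrow>
      (AE x in lborel. ennreal (G x) \<le> (\<integral>\<^sup>+ y. ennreal (norm (x - y) powr (s - real DIM('a)) * F y) \<partial>lborel)) \<longrightarrow>
      (\<integral>\<^sup>+ x. ennreal (G x powr p / norm x powr (s * p)) \<partial>lborel) \<le> ennreal A * (\<integral>\<^sup>+ y. ennreal (F y powr p) \<partial>lborel)"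
proof -
  define n where "n = real DIM('a)"
  have sp: "s * p < n" using p s by (simp add: n_def field_simps)
  have sn: "s < n" using mult_strict_left_mono[of 1 p s] sp p s(1) by linarith
  \<comment> \<open>This is \<open>s * p < n\<close> rearranged, and
    \<open>a < (n - s) / (p - 1)\<close> is exactly the condition \<open>b < n\<close>.\<close>
  have "s < (n - s) / (p - 1)" using p sp by (simp add: field_simps)
  then obtain a where a: "s < a" "a < n" "a < (n - s) / (p - 1)"
    using dense[of s "min n ((n - s) / (p - 1))"] sn by auto
  define b where "b = s + a * (p - 1)"
  have "a * (p - 1) > 0" using a s p by simp
  then have b: "s < b" "b < n" using a p by (auto simp: b_def field_simps)
  obtain A where A: "A > 0" "\<And>x::'a. x \<noteq> 0 \<Longrightarrow>
     (\<integral>\<^sup>+ y. ennreal (norm (x - y) powr (s - n) * norm y powr (-a)) \<partial>lborel) \<le> ennreal (A * norm x powr (s - a))"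
    using riesz_kernel_norm_powr_le[where 'a = 'a, of s a] a s unfolding n_def by auto
  obtain B where B: "B > 0" "\<And>y::'a. y \<noteq> 0 \<Longrightarrow>
     (\<integral>\<^sup>+ x. ennreal (norm (y - x) powr (s - n) * norm x powr (-b)) \<partial>lborel) \<le> ennreal (B * norm y powr (s - b))"
    using riesz_kernel_norm_powr_le[where 'a = 'a, of s b] b s unfolding n_def by auto
  define c where "c = 2 powr p * A powr (p - 1)"
  have nz: "AE x::'a in lborel. x \<noteq> 0" by (rule AE_lborel_singleton)
  show ?thesis
  proof (intro exI[of _ "c * B"] conjI allI impI)
    show "0 \<le> c * B" using B by (simp add: c_def)
    fix F G :: "'a \<Rightarrow> real"
    assume [measurable]: "F \<in> borel_measurable borel" and F: "\<forall>y. 0 \<le> F y" and G: "\<forall>x. 0 \<le> G x"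
      and GF: "AE x in lborel. ennreal (G x) \<le> (\<integral>\<^sup>+ y. ennreal (norm (x - y) powr (s - real DIM('a)) * F y) \<partial>lborel)"
    \<comment> \<open>The double integrand left by Hoelder in y: \<open>norm x powr (-b)\<close>
      collects the Hardy weight \<open>norm x powr (-(s * p))\<close> and the factor
      \<open>(norm x powr (s - a)) powr (p - 1)\<close> from the first kernel bound.\<close>
    define H where "H x y = ennreal c * ennreal (norm x powr (-b)) * ennreal (norm (x - y) powr (s - n) * (F y powr p * (norm y powr (-a)) powr (1 - p)))" for x y :: 'a
    have [measurable]: "case_prod H \<in> borel_measurable (lborel \<Otimes>\<^sub>M lborel)"
      unfolding H_def[abs_def] by measurable
    have "(\<integral>\<^sup>+ x. ennreal (G x powr p / norm x powr (s * p)) \<partial>lborel) \<le> (\<integral>\<^sup>+ x. (\<integral>\<^sup>+ y. H x y \<partial>lborel) \<partial>lborel)"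
      using nz GF
    proof (intro nn_integral_mono_AE, eventually_elim)
      case (elim x)
      define D where "D = (\<integral>\<^sup>+ y. ennreal (norm (x - y) powr (s - n) * (F y powr p * (norm y powr (-a)) powr (1 - p))) \<partial>lborel)"
      have w: "AE y::'a in lborel. 0 < norm y powr (-a)"
        using nz by eventually_elim simp
      \<comment> \<open>Weighted Hoelder with kernel \<open>norm (x - y) powr (s - n)\<close>,
        weight \<open>norm y powr (-a)\<close> and bound
        \<open>A * norm x powr (s - a)\<close>.\<close>
      have "ennreal (G x powr p) \<le> ennreal (2 powr p * (A * norm x powr (s - a)) powr (p - 1)) * D"
        unfolding D_def
        using elim F G A(1) A(2)[of x] p w
        by (intro powr_nn_integral_weight_le) (auto simp: n_def)
      then have "ennreal (1 / norm x powr (s * p)) * ennreal (G x powr p)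
          \<le> ennreal (1 / norm x powr (s * p)) * (ennreal (2 powr p * (A * norm x powr (s - a)) powr (p - 1)) * D)"
        by (rule mult_left_mono) simp
      also have "\<dots> = ennreal (1 / norm x powr (s * p) * (2 powr p * (A * norm x powr (s - a)) powr (p - 1))) * D"
        by (subst ennreal_mult) (auto simp: mult.assoc)
      also have "1 / norm x powr (s * p) * (2 powr p * (A * norm x powr (s - a)) powr (p - 1)) = c * norm x powr (-b)"
      proof -
        have "norm x powr (- (s * p)) * norm x powr ((s - a) * (p - 1)) = norm x powr (-b)"
          by (simp add: b_def algebra_simps flip: powr_add)
        then show ?thesis
          using A by (simp add: c_def powr_mult powr_powr powr_minus field_simps)
      qed
      also have "ennreal (c * norm x powr (-b)) * D = (\<integral>\<^sup>+ y. H x y \<partial>lborel)"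
        unfolding D_def H_def by (subst nn_integral_cmult) (auto simp: c_def ennreal_mult)
      finally show ?case by (simp flip: ennreal_mult)
    qed
    also have "\<dots> = (\<integral>\<^sup>+ y. (\<integral>\<^sup>+ x. H x y \<partial>lborel) \<partial>lborel)"
      by (rule lborel_pair.Fubini'[symmetric]) simp
    also have "\<dots> \<le> (\<integral>\<^sup>+ y. ennreal (c * B) * ennreal (F y powr p) \<partial>lborel)"
      using nz
    proof (intro nn_integral_mono_AE, eventually_elim)
      case (elim y)
      \<comment> \<open>The leftover weight is
        \<open>norm y powr (a * (p - 1)) = norm y powr (b - s)\<close>, which cancels the power
        produced by the second kernel bound.\<close>
      have "(\<integral>\<^sup>+ x. H x y \<partial>lborel) = (\<integral>\<^sup>+ x. ennreal (c * F y powr p * norm y powr (b - s)) * ennreal (norm (y - x) powr (s - n) * norm x powr (-b)) \<partial>lborel)"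
        by (intro nn_integral_cong)
           (simp add: H_def c_def powr_powr b_def algebra_simps norm_minus_commute flip: ennreal_mult)
      also have "\<dots> \<le> ennreal (c * F y powr p * norm y powr (b - s)) * ennreal (B * norm y powr (s - b))"
        by (subst nn_integral_cmult) (auto intro!: mult_left_mono B elim)
      also have "\<dots> = ennreal (c * B) * ennreal (F y powr p)"
      proof -
        have "norm y powr (b - s) * norm y powr (s - b) = 1" using elim by (simp flip: powr_add)
        then have "c * F y powr p * norm y powr (b - s) * (B * norm y powr (s - b)) = c * B * F y powr p"
          by (simp add: mult_ac)
        then show ?thesis using B by (simp add: c_def flip: ennreal_mult)
      qed
      finally show ?case .
    qed
    also have "\<dots> = ennreal (c * B) * (\<integral>\<^sup>+ y. ennreal (F y powr p) \<partial>lborel)"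
      by (subst nn_integral_cmult) auto
    finally show "(\<integral>\<^sup>+ x. ennreal (G x powr p / norm x powr (s * p)) \<partial>lborel) \<le> ennreal (c * B) * (\<integral>\<^sup>+ y. ennreal (F y powr p) \<partial>lborel)" .
  qed
qed

section \<open>Passage to Riesz potentials and the Sobolev norm\<close>

lemma riesz_potential_weighted_le:
  fixes p s :: real
  assumes p: "1 < p" and s: "0 \<le> s" "s < real CARD('n::finite) / p"
  shows "\<exists>C\<ge>0. \<forall>f \<in> (Lp_space p :: (real^'n \<Rightarrow> complex) set).
           (\<integral>\<^sup>+ x. ennreal (norm (riesz_potential s f x) powr p / norm x powr (s * p)) \<partial>lebesgue)
             \<le> ennreal C * (\<integral>\<^sup>+ x. ennreal (norm (f x) powr p) \<partial>lebesgue)"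
proof (cases "s = 0")
  case True
  \<comment> \<open>The potential is the identity here. The weight is 1 off the origin, but
    \<open>0 powr 0 = 0\<close> and division by 0 gives 0 at the origin, hence an
    inequality.\<close>
  have "(\<integral>\<^sup>+ x. ennreal (norm (riesz_potential s f x) powr p / norm x powr (s * p)) \<partial>lebesgue)
      \<le> ennreal 1 * (\<integral>\<^sup>+ x. ennreal (norm (f x) powr p) \<partial>lebesgue)" for f :: "real^'n \<Rightarrow> complex"
    using True by (auto simp: riesz_potential_def intro!: nn_integral_mono)
  then show ?thesis by (intro exI[of _ 1]) auto
next
  case False
  define n where "n = real CARD('n)"
  obtain A where A: "A \<ge> 0" "\<And>(F :: real^'n \<Rightarrow> real) G. \<lbrakk>F \<in> borel_measurable borel; \<And>y. 0 \<le> F y; \<And>x. 0 \<le> G x;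
      AE x in lborel. ennreal (G x) \<le> (\<integral>\<^sup>+ y. ennreal (norm (x - y) powr (s - n) * F y) \<partial>lborel)\<rbrakk> \<Longrightarrow>
      (\<integral>\<^sup>+ x. ennreal (G x powr p / norm x powr (s * p)) \<partial>lborel) \<le> ennreal A * (\<integral>\<^sup>+ y. ennreal (F y powr p) \<partial>lborel)"
    using nn_integral_riesz_weighted_le[where 'a = "real^'n", of p s] p s False unfolding n_def by auto
  define \<gamma> where "\<gamma> = \<bar>riesz_const CARD('n) s\<bar>"
  have \<gamma>: "\<gamma> \<ge> 0" by (simp add: \<gamma>_def)
  show ?thesis
  proof (intro exI[of _ "A * \<gamma> powr p"] conjI ballI)
    show "0 \<le> A * \<gamma> powr p" using A by simp
    fix f :: "real^'n \<Rightarrow> complex" assume "f \<in> Lp_space p"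
    then have "(\<lambda>x. norm (f x)) \<in> borel_measurable lebesgue"
      by (auto simp: Lp_space_def)
    then obtain g where g [measurable]: "g \<in> borel_measurable lborel" and gf: "AE x in lborel. norm (f x) = g x"
      using completion_ex_borel_measurable_real[of "\<lambda>x. norm (f x)" lborel] by auto
    \<comment> \<open>\<open>g\<close> is a Borel version of the modulus of \<open>f\<close>; the
      absolute value restores nonnegativity on the exceptional null set, and the Riesz constant is
      absorbed into \<open>F\<close>.\<close>
    define F where "F x = \<gamma> * \<bar>g x\<bar>" for x
    have [measurable]: "F \<in> borel_measurable borel" using g by (simp add: F_def[abs_def])
    have gf': "AE x in lborel. norm (f x) = \<bar>g x\<bar>"
      using gf by eventually_elim (metis abs_norm_cancel)
    have bound: "ennreal (norm (riesz_potential s f x)) \<le> (\<integral>\<^sup>+ y. ennreal (norm (x - y) powr (s - n) * F y) \<partial>lborel)" for x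
    proof -
      let ?k = "\<lambda>y. (norm (x - y) powr (s - n)) *\<^sub>R f y"
      \<comment> \<open>If \<open>?k\<close> is not integrable, its Bochner integral is 0 and the
        bound is trivial.\<close>
      have "ennreal (norm (LINT y|lebesgue. ?k y)) \<le> (\<integral>\<^sup>+ y. ennreal (norm (?k y)) \<partial>lebesgue)"
        by (cases "integrable lebesgue ?k") (auto simp: not_integrable_integral_eq intro: integral_norm_bound_ennreal simp del: norm_scaleR)
      then have "ennreal (norm (riesz_potential s f x)) \<le> ennreal \<gamma> * (\<integral>\<^sup>+ y. ennreal (norm (?k y)) \<partial>lebesgue)"
        using False by (simp add: riesz_potential_def \<gamma>_def n_def ennreal_mult mult_left_mono)
      also have "(\<integral>\<^sup>+ y. ennreal (norm (?k y)) \<partial>lebesgue) = (\<integral>\<^sup>+ y. ennreal (norm (x - y) powr (s - n) * \<bar>g y\<bar>) \<partial>lborel)"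
        unfolding nn_integral_completion by (intro nn_integral_cong_AE eventually_mono[OF gf']) simp
      also have "ennreal \<gamma> * \<dots> = (\<integral>\<^sup>+ y. ennreal \<gamma> * ennreal (norm (x - y) powr (s - n) * \<bar>g y\<bar>) \<partial>lborel)"
        by (rule nn_integral_cmult[symmetric]) measurable
      also have "\<dots> = (\<integral>\<^sup>+ y. ennreal (norm (x - y) powr (s - n) * F y) \<partial>lborel)"
        using \<gamma> by (intro nn_integral_cong) (simp add: F_def mult_ac flip: ennreal_mult)
      finally show ?thesis .
    qed
    have "(\<integral>\<^sup>+ x. ennreal (norm (riesz_potential s f x) powr p / norm x powr (s * p)) \<partial>lebesgue)
        \<le> ennreal A * (\<integral>\<^sup>+ y. ennreal (F y powr p) \<partial>lborel)"
      unfolding nn_integral_completion using bound \<gamma> by (intro A) (auto simp: F_def)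
    also have "(\<integral>\<^sup>+ y. ennreal (F y powr p) \<partial>lborel) = (\<integral>\<^sup>+ y. ennreal (\<gamma> powr p) * ennreal (\<bar>g y\<bar> powr p) \<partial>lborel)"
      using \<gamma> by (intro nn_integral_cong) (simp add: F_def powr_mult flip: ennreal_mult)
    also have "\<dots> = ennreal (\<gamma> powr p) * (\<integral>\<^sup>+ y. ennreal (\<bar>g y\<bar> powr p) \<partial>lborel)"
      by (rule nn_integral_cmult) measurable
    also have "(\<integral>\<^sup>+ y. ennreal (\<bar>g y\<bar> powr p) \<partial>lborel) = (\<integral>\<^sup>+ y. ennreal (norm (f y) powr p) \<partial>lborel)"
      by (intro nn_integral_cong_AE eventually_mono[OF gf']) simp
    finally show "(\<integral>\<^sup>+ x. ennreal (norm (riesz_potential s f x) powr p / norm x powr (s * p)) \<partial>lebesgue)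
        \<le> ennreal (A * \<gamma> powr p) * (\<integral>\<^sup>+ x. ennreal (norm (f x) powr p) \<partial>lebesgue)"
      using A by (simp add: nn_integral_completion ennreal_mult mult.assoc)
  qed
qed

theorem mainTheorem1:
  fixes p s :: real
  assumes "1 < p" and "0 \<le> s" and "s < real CARD('n::finite) / p"
  shows "\<exists>C\<ge>0. \<forall>u \<in> (hom_sobolev_space s p :: (real^'n \<Rightarrow> complex) set).
           (\<integral>\<^sup>+ x. ennreal (norm (u x) powr p / norm x powr (s * p)) \<partial>lebesgue)
             \<le> ennreal (C * hom_sobolev_norm s p u powr p)"
proof -
  obtain C where C: "C \<ge> 0" "\<And>f :: real^'n \<Rightarrow> complex. f \<in> Lp_space p \<Longrightarrow>
           (\<integral>\<^sup>+ x. ennreal (norm (riesz_potential s f x) powr p / norm x powr (s * p)) \<partial>lebesgue)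
             \<le> ennreal C * (\<integral>\<^sup>+ x. ennreal (norm (f x) powr p) \<partial>lebesgue)"
    using riesz_potential_weighted_le[OF assms] by auto
  show ?thesis
  proof (intro exI[of _ C] conjI ballI C)
    fix u :: "real^'n \<Rightarrow> complex" assume u: "u \<in> hom_sobolev_space s p"
    define f where "f = riesz_inverse s p u"
    have "\<exists>f. f \<in> Lp_space p \<and> (AE x in lebesgue. u x = riesz_potential s f x)"
      using u by (auto simp: hom_sobolev_space_def)
    from someI_ex[OF this] have f: "f \<in> Lp_space p" "AE x in lebesgue. u x = riesz_potential s f x"
      unfolding f_def riesz_inverse_def by blast+
    have int: "integrable lebesgue (\<lambda>x. norm (f x) powr p)" using f by (simp add: Lp_space_def)
    have "(\<integral>\<^sup>+ x. ennreal (norm (u x) powr p / norm x powr (s * p)) \<partial>lebesgue)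
        = (\<integral>\<^sup>+ x. ennreal (norm (riesz_potential s f x) powr p / norm x powr (s * p)) \<partial>lebesgue)"
      by (intro nn_integral_cong_AE eventually_mono[OF f(2)]) simp
    also have "\<dots> \<le> ennreal C * (\<integral>\<^sup>+ x. ennreal (norm (f x) powr p) \<partial>lebesgue)" by (rule C f)+
    also have "\<dots> = ennreal (C * (LINT x|lebesgue. norm (f x) powr p))"
      using C int by (simp add: nn_integral_eq_integral ennreal_mult)
    \<comment> \<open>The power p undoes the root \<open>1 / p\<close> in \<open>Lp_norm\<close>,
      the integral being nonnegative.\<close>
    also have "(LINT x|lebesgue. norm (f x) powr p) = hom_sobolev_norm s p u powr p"
      using assms by (simp add: hom_sobolev_norm_def Lp_norm_def f_def powr_powr)
    finally show "(\<integral>\<^sup>+ x. ennreal (norm (u x) powr p / norm x powr (s * p)) \<partial>lebesgue)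
             \<le> ennreal (C * hom_sobolev_norm s p u powr p)" .
  qed
qed

end
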